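(* Let $\Omega=\{w\in\mathbb P^1 : |(\tfrac1w-1)^3+1|>e^{-1/3}\}$, which is a bounded domain in $\mathbb C$ containing $0$, and let $G$ be the Green function of $\Omega$ with pole at $0$, that is, $$G(w)=\frac13\log\left|\frac{w^3}{1-3w+3w^2}\right|-\frac19,\qquad w\in\Omega.$$ Let $\lambda$ denote Lebesgue measure on $\mathbb C$. Then the function $$t\mapsto \log\lambda(\{w\in\Omega : G(w)<t\}),\qquad -\infty<t<0,$$ is not convex on $(-\infty,0)$.
   Context: $\mathbb P^1=\mathbb C\cup\{\infty\}$ is the Riemann sphere, and the expression $|(\frac1w-1)^3+1|$ is evaluated with $\frac10=\infty$, $\frac1\infty=0$; thus $0\in\Omega$ and $\infty\notin\Omega$, and for $w\in\mathbb C$ one has $w\in\Omega$ if and only if $|w|^3<e^{1/3}|1-3w+3w^2|$. The convention $G(0)=-\infty$ is used. The Green function of a bounded domain $\Omega\subset\mathbb C$ (with sufficiently regular boundary) with pole at $q\in\Omega$ is the unique function $G:\Omega\to[-\infty,0)$ that is harmonic on $\Omega\setminus\{q\}$, satisfies $G(z)=\log|z-q|+O(1)$ as $z\to q$, and tends to $0$ at every boundary point of $\Omega$. *)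

theory Defs
  imports "HOL-Analysis.Analysis" "HOL-Library.Landau_Symbols"
begin

datatype csphere = Fin complex | Infty

fun csphere_recip :: "csphere \<Rightarrow> csphere" where
  "csphere_recip (Fin w) = (if w = 0 then Infty else Fin (1 / w))"
| "csphere_recip Infty = Fin 0"

fun csphere_cubic :: "csphere \<Rightarrow> csphere" where
  "csphere_cubic (Fin z) = Fin ((z - 1) ^ 3 + 1)"
| "csphere_cubic Infty = Infty"

fun csphere_abs :: "csphere \<Rightarrow> ereal" where
  "csphere_abs (Fin z) = ereal (cmod z)"
| "csphere_abs Infty = \<infinity>"

definition Omega_sphere :: "csphere set" where
  "Omega_sphere =
     {w. csphere_abs (csphere_cubic (csphere_recip w)) > ereal (exp (- 1 / 3))}"

definition Omega :: "complex set" where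
  "Omega = {w. Fin w \<in> Omega_sphere}"

text \<open>A harmonic function on an open set: twice continuously differentiable with vanishing
  Laplacian. The witnesses are the first and second order partial derivatives of \<open>u\<close>
  with respect to the real and imaginary part.\<close>

definition harmonic_on :: "(complex \<Rightarrow> real) \<Rightarrow> complex set \<Rightarrow> bool" where
  "harmonic_on u S \<longleftrightarrow> open S \<and>
     (\<exists>ux uy uxx uxy uyx uyy :: complex \<Rightarrow> real.
        (\<forall>z\<in>S. (u has_derivative (\<lambda>h. ux z * Re h + uy z * Im h)) (at z)) \<and>
        (\<forall>z\<in>S. (ux has_derivative (\<lambda>h. uxx z * Re h + uxy z * Im h)) (at z)) \<and>
        (\<forall>z\<in>S. (uy has_derivative (\<lambda>h. uyx z * Re h + uyy z * Im h)) (at z)) \<and>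
        continuous_on S uxx \<and> continuous_on S uxy \<and>
        continuous_on S uyx \<and> continuous_on S uyy \<and>
        (\<forall>z\<in>S. uxx z + uyy z = 0))"

text \<open>Values of \<open>G\<close> outside \<open>D\<close> are irrelevant. The function is extended-real valued
  because it equals \<open>-\<infinity>\<close> at the pole.\<close>

definition is_green_function :: "complex set \<Rightarrow> complex \<Rightarrow> (complex \<Rightarrow> ereal) \<Rightarrow> bool" where
  "is_green_function D q G \<longleftrightarrow>
     q \<in> D \<and> G q = -\<infinity> \<and>
     (\<forall>z\<in>D. G z < 0) \<and>
     (\<forall>z\<in>D - {q}. \<bar>G z\<bar> \<noteq> \<infinity>) \<and>
     harmonic_on (\<lambda>z. real_of_ereal (G z)) (D - {q}) \<and>
     (\<lambda>z. real_of_ereal (G z) - ln (cmod (z - q))) \<in> O[at q](\<lambda>_. 1) \<and>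
     (\<forall>\<zeta>\<in>frontier D. (G \<longlongrightarrow> 0) (at \<zeta> within D))"

text \<open>The value at 0 is set separately, since \<open>ln 0 = 0\<close> for the real logarithm.\<close>

definition G_Omega :: "complex \<Rightarrow> ereal" where
  "G_Omega w =
     (if w = 0 then -\<infinity>
      else ereal (1 / 3 * ln (cmod (w ^ 3 / (1 - 3 * w + 3 * w ^ 2))) - 1 / 9))"

end

theory Submission
  imports Defs
begin

text \<open>
  Clearing denominators turns \<open>\<Omega>\<close> into the set where
  \<open>\<bar>w\<bar>^3 < exp (1/3) * \<bar>Q w\<bar>\<close> with \<open>Q w = 1 - 3 * w + 3 * w^2\<close>, and the set where the explicit
  function lies below \<open>t\<close> into the one where \<open>\<bar>w\<bar>^3 < exp (3 * t + 1/3) * \<bar>Q w\<bar>\<close>.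

  The failure of convexity comes from a degenerate critical point of the Green function.  Since
  \<open>Q w = w^3 - (w - 1)^3\<close>, the function \<open>3 * G w + 1/3\<close> equals \<open>- ln \<bar>1 - ((w - 1) / w)^3\<bar>\<close> and is
  therefore of size \<open>O(r^3)\<close> on the disc of radius \<open>r\<close> about \<open>1\<close>: near the level \<open>t = - 1/9\<close> a whole disc
  of radius \<open>r\<close> is swept while the level changes only by \<open>O(r^3)\<close>
  (lemma \<open>ball_between_sublevels\<close>).  The area thus jumps by at least
  \<open>pi * r^2\<close> over an interval of length \<open>O(r^3)\<close>, so its logarithm has infinite slope at an
  interior point of \<open>(-\<infinity>, 0)\<close>.  A convex function on an open interval has bounded difference quotients
  near each interior point, which is the contradiction in \<open>not_convex_log_area\<close>.

  The statements about Green functions rest on one maximum principle, proved by the second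
  derivative test after adding a small multiple of \<open>\<bar>z\<bar>^2\<close>.  For uniqueness, two Green functions \<open>G\<close> and
  \<open>H\<close> are compared through \<open>G - (1 - e) * H\<close>, which tends to \<open>-\<infinity>\<close> at the pole.  Connectedness
  of \<open>\<Omega>\<close> follows from the mere existence of a Green function: a component that misses the pole would
  carry a negative harmonic function with boundary values zero.  That the explicit function is
  harmonic holds because \<open>ln \<bar>f\<bar>\<close> has gradient given by the holomorphic function \<open>f' / f\<close>.
\<close>

section \<open>Harmonic functions\<close>

lemma harmonic_onI:
  assumes "open S"
    "\<And>z. z \<in> S \<Longrightarrow> (u has_derivative (\<lambda>h. ux z * Re h + uy z * Im h)) (at z)"
    "\<And>z. z \<in> S \<Longrightarrow> (ux has_derivative (\<lambda>h. uxx z * Re h + uxy z * Im h)) (at z)"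
    "\<And>z. z \<in> S \<Longrightarrow> (uy has_derivative (\<lambda>h. uyx z * Re h + uyy z * Im h)) (at z)"
    "continuous_on S uxx" "continuous_on S uxy" "continuous_on S uyx" "continuous_on S uyy"
    "\<And>z. z \<in> S \<Longrightarrow> uxx z + uyy z = 0"
  shows "harmonic_on u S"
  unfolding harmonic_on_def
  by (intro conjI exI[of _ ux] exI[of _ uy] exI[of _ uxx] exI[of _ uxy] exI[of _ uyx]
      exI[of _ uyy] ballI assms)

lemma harmonic_on_lincomb:
  assumes "harmonic_on u S" "harmonic_on v S"
  shows "harmonic_on (\<lambda>z. a * u z + b * v z) S"
proof -
  obtain ux uy uxx uxy uyx uyy where u: "open S"
    "\<And>z. z \<in> S \<Longrightarrow> (u has_derivative (\<lambda>h. ux z * Re h + uy z * Im h)) (at z)"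
    "\<And>z. z \<in> S \<Longrightarrow> (ux has_derivative (\<lambda>h. uxx z * Re h + uxy z * Im h)) (at z)"
    "\<And>z. z \<in> S \<Longrightarrow> (uy has_derivative (\<lambda>h. uyx z * Re h + uyy z * Im h)) (at z)"
    "continuous_on S uxx" "continuous_on S uxy" "continuous_on S uyx" "continuous_on S uyy"
    "\<And>z. z \<in> S \<Longrightarrow> uxx z + uyy z = 0"
    using assms(1) unfolding harmonic_on_def by blast
  obtain vx vy vxx vxy vyx vyy where v: "open S"
    "\<And>z. z \<in> S \<Longrightarrow> (v has_derivative (\<lambda>h. vx z * Re h + vy z * Im h)) (at z)"
    "\<And>z. z \<in> S \<Longrightarrow> (vx has_derivative (\<lambda>h. vxx z * Re h + vxy z * Im h)) (at z)"
    "\<And>z. z \<in> S \<Longrightarrow> (vy has_derivative (\<lambda>h. vyx z * Re h + vyy z * Im h)) (at z)"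
    "continuous_on S vxx" "continuous_on S vxy" "continuous_on S vyx" "continuous_on S vyy"
    "\<And>z. z \<in> S \<Longrightarrow> vxx z + vyy z = 0"
    using assms(2) unfolding harmonic_on_def by blast
  have lin: "((\<lambda>z. a * p z + b * q z) has_derivative
      (\<lambda>h. (a * px z + b * qx z) * Re h + (a * py z + b * qy z) * Im h)) (at z)"
    if "(p has_derivative (\<lambda>h. px z * Re h + py z * Im h)) (at z)"
      "(q has_derivative (\<lambda>h. qx z * Re h + qy z * Im h)) (at z)"
    for p q px py qx qy :: "complex \<Rightarrow> real" and z
    by (rule has_derivative_eq_rhs[OF has_derivative_add
          [OF has_derivative_mult_right[OF that(1), of a] has_derivative_mult_right[OF that(2), of b]]])
      (auto simp: algebra_simps)
  have lap: "(a * uxx z + b * vxx z) + (a * uyy z + b * vyy z) = 0" if "z \<in> S" for z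
  proof -
    have "uyy z = - uxx z" "vyy z = - vxx z" using u(9) v(9) that by (smt (verit))+
    then show ?thesis by simp
  qed
  show ?thesis
    by (rule harmonic_onI, rule u(1), (rule lin[OF u(2) v(2)] lin[OF u(3) v(3)] lin[OF u(4) v(4)]; assumption)+)
      (intro continuous_intros u(5-8) v(5-8) lap; assumption)+
qed

lemma harmonic_on_cong:
  assumes "harmonic_on u S" and eq: "\<And>z. z \<in> S \<Longrightarrow> u z = v z"
  shows "harmonic_on v S"
proof -
  obtain ux uy uxx uxy uyx uyy where u: "open S"
    "\<And>z. z \<in> S \<Longrightarrow> (u has_derivative (\<lambda>h. ux z * Re h + uy z * Im h)) (at z)"
    "\<And>z. z \<in> S \<Longrightarrow> (ux has_derivative (\<lambda>h. uxx z * Re h + uxy z * Im h)) (at z)"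
    "\<And>z. z \<in> S \<Longrightarrow> (uy has_derivative (\<lambda>h. uyx z * Re h + uyy z * Im h)) (at z)"
    "continuous_on S uxx" "continuous_on S uxy" "continuous_on S uyx" "continuous_on S uyy"
    "\<And>z. z \<in> S \<Longrightarrow> uxx z + uyy z = 0"
    using assms(1) unfolding harmonic_on_def by blast
  have "(v has_derivative (\<lambda>h. ux z * Re h + uy z * Im h)) (at z)" if "z \<in> S" for z
    using u(2)[OF that] u(1) that eq by (rule has_derivative_transform_within_open)
  with u show ?thesis by (intro harmonic_onI)
qed

lemma harmonic_on_subset:
  assumes "harmonic_on u S" "open T" "T \<subseteq> S"
  shows "harmonic_on u T"
proof -
  obtain ux uy uxx uxy uyx uyy where u: "open S"
    "\<And>z. z \<in> S \<Longrightarrow> (u has_derivative (\<lambda>h. ux z * Re h + uy z * Im h)) (at z)"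
    "\<And>z. z \<in> S \<Longrightarrow> (ux has_derivative (\<lambda>h. uxx z * Re h + uxy z * Im h)) (at z)"
    "\<And>z. z \<in> S \<Longrightarrow> (uy has_derivative (\<lambda>h. uyx z * Re h + uyy z * Im h)) (at z)"
    "continuous_on S uxx" "continuous_on S uxy" "continuous_on S uyx" "continuous_on S uyy"
    "\<And>z. z \<in> S \<Longrightarrow> uxx z + uyy z = 0"
    using assms(1) unfolding harmonic_on_def by blast
  show ?thesis
    by (rule harmonic_onI[where ux = ux and uy = uy and uxx = uxx and uxy = uxy
          and uyx = uyx and uyy = uyy])
      (use u assms(2,3) continuous_on_subset in blast)+
qed

text \<open>The gradient of \<open>u\<close> is the conjugate of \<open>h\<close>, so the Cauchy-Riemann equations for \<open>h\<close> make the
  Laplacian of \<open>u\<close> vanish: the pure second derivatives are \<open>Re h'\<close> and \<open>- Re h'\<close>.\<close>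

lemma harmonic_on_Re_antiderivative:
  assumes "open S"
    and u: "\<And>z. z \<in> S \<Longrightarrow> (u has_derivative (\<lambda>k. Re (h z * k))) (at z)"
    and h: "\<And>z. z \<in> S \<Longrightarrow> (h has_field_derivative h' z) (at z)"
    and h': "continuous_on S h'"
  shows "harmonic_on u S"
proof -
  have hRe: "((\<lambda>z. Re (h z)) has_derivative (\<lambda>k. Re (h' z * k))) (at z)" 
    and hIm: "((\<lambda>z. - Im (h z)) has_derivative (\<lambda>k. - Im (h' z * k))) (at z)" if "z \<in> S" for z
    using h[OF that] unfolding has_field_derivative_def
    by (auto intro!: derivative_eq_intros)
  show ?thesis
    by (rule harmonic_onI[where ux = "\<lambda>z. Re (h z)" and uy = "\<lambda>z. - Im (h z)"
          and uxx = "\<lambda>z. Re (h' z)" and uxy = "\<lambda>z. - Im (h' z)"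
          and uyx = "\<lambda>z. - Im (h' z)" and uyy = "\<lambda>z. - Re (h' z)"])
      (use u hRe hIm in \<open>auto intro!: continuous_intros \<open>open S\<close> h' simp: algebra_simps\<close>)
qed

text \<open>Locally \<open>ln \<bar>f\<bar>\<close> is the real part of a branch of the logarithm of \<open>f\<close>, whence the logarithmic
  derivative; differentiating the norm directly avoids choosing a branch.\<close>

lemma has_derivative_ln_cmod:
  assumes f: "(f has_field_derivative f') (at z)" and "f z \<noteq> 0"
  shows "((\<lambda>z. ln (cmod (f z))) has_derivative (\<lambda>k. Re (f' / f z * k))) (at z)"
proof -
  have eq: "inverse (cmod a) * (sgn a \<bullet> (f' * k)) = Re (f' / a * k)" if "a \<noteq> 0" for a k
  proof -
    have "Re (f' / a * k) = Re (f' * k / a)" by simp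
    also have "\<dots> = (a \<bullet> (f' * k)) / (cmod a)\<^sup>2"
      by (simp only: Re_divide inner_complex_def cmod_power2 mult.commute)
    finally show ?thesis by (simp add: sgn_div_norm power2_eq_square divide_inverse)
  qed
  have "((\<lambda>z. cmod (f z)) has_derivative (\<lambda>k. sgn (f z) \<bullet> (f' * k))) (at z)"
    using has_derivative_compose[where f = f and f' = "\<lambda>k. f' * k" and g = norm and g' = "\<lambda>k. sgn (f z) \<bullet> k"]
      has_derivative_norm[OF \<open>f z \<noteq> 0\<close>] f
    by (simp add: has_field_derivative_def inner_commute)
  from has_derivative_ln[OF _ this] \<open>f z \<noteq> 0\<close>
  have "((\<lambda>z. ln (cmod (f z))) has_derivative
      (\<lambda>k. (sgn (f z) \<bullet> (f' * k)) * inverse (cmod (f z)))) (at z)"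
    by simp
  then show ?thesis
    by (simp only: mult.commute[of _ "inverse _"] eq[OF \<open>f z \<noteq> 0\<close>])
qed

section \<open>The maximum principle\<close>

text \<open>A positive second derivative at the critical point \<open>0\<close> would make \<open>f'\<close> positive, hence \<open>f\<close>
  increasing, just to the right of \<open>0\<close>.\<close>

lemma local_max_second_derivative_nonpos:
  fixes f f' :: "real \<Rightarrow> real"
  assumes "0 < d"
    and f: "\<And>s. \<bar>s\<bar> < d \<Longrightarrow> (f has_real_derivative f' s) (at s)"
    and f': "(f' has_real_derivative c) (at 0)"
    and max: "\<And>s. \<bar>s\<bar> < d \<Longrightarrow> f s \<le> f 0"
  shows "c \<le> 0"
proof (rule ccontr)
  assume "\<not> c \<le> 0"
  have "f' 0 = 0"
    using DERIV_local_max[OF f[of 0] \<open>0 < d\<close>] max \<open>0 < d\<close> by auto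
  then obtain e where e: "0 < e" "\<And>h. 0 < h \<Longrightarrow> h < e \<Longrightarrow> 0 < f' h"
    using DERIV_pos_inc_right[OF f'] \<open>\<not> c \<le> 0\<close> by auto
  define s where "s = min d e / 2"
  have s: "0 < s" "s < d" "s < e" using e \<open>0 < d\<close> by (auto simp: s_def)
  obtain x where x: "0 < x" "x < s" "f s - f 0 = (s - 0) * f' x"
    using MVT2[of 0 s f f'] f s by auto
  have "0 < s * f' x" using x s e(2)[of x] by auto
  then show False using x max[of s] s by auto
qed

lemma has_real_derivative_along_line:
  assumes "(v has_derivative (\<lambda>h. a * Re h + b * Im h)) (at (p + c * of_real s))"
  shows "((\<lambda>s. v (p + c * of_real s)) has_real_derivative a * Re c + b * Im c) (at s)"
proof -
  have "((\<lambda>s::real. p + c * of_real s) has_derivative (\<lambda>h. c * of_real h)) (at s)"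
    by (auto intro!: derivative_eq_intros)
  from has_derivative_compose[OF this, where g = v and g' = "\<lambda>h. a * Re h + b * Im h"] assms
  have "((\<lambda>s. v (p + c * of_real s)) has_derivative
      (\<lambda>h. a * Re (c * of_real h) + b * Im (c * of_real h))) (at s)" by blast
  then show ?thesis
    unfolding has_field_derivative_def
    by (rule has_derivative_eq_rhs) (auto simp: algebra_simps)
qed

text \<open>The boundary condition bounds the upper limit at each boundary point and asks for no limit, so
  that it also covers functions tending to \<open>-\<infinity>\<close> at a puncture.  If \<open>v\<close> were positive somewhere,
  adding a small multiple of \<open>\<bar>z\<bar>^2\<close> would keep an interior maximum, at which both pure second
  derivatives are nonpositive although their sum has become positive.\<close>

lemma harmonic_maximum_principle:
  assumes "bounded D" and harm: "harmonic_on v D"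
    and bdry: "\<And>\<zeta> e. \<zeta> \<in> frontier D \<Longrightarrow> 0 < e \<Longrightarrow> \<forall>\<^sub>F z in at \<zeta> within D. v z < e"
    and "z0 \<in> D"
  shows "v z0 \<le> 0"
proof (rule ccontr)
  assume "\<not> v z0 \<le> 0"
  then have pos: "0 < v z0" by simp
  obtain ux uy uxx uxy uyx uyy where u: "open D"
    "\<And>z. z \<in> D \<Longrightarrow> (v has_derivative (\<lambda>h. ux z * Re h + uy z * Im h)) (at z)"
    "\<And>z. z \<in> D \<Longrightarrow> (ux has_derivative (\<lambda>h. uxx z * Re h + uxy z * Im h)) (at z)"
    "\<And>z. z \<in> D \<Longrightarrow> (uy has_derivative (\<lambda>h. uyx z * Re h + uyy z * Im h)) (at z)"
    "continuous_on D uxx" "continuous_on D uxy" "continuous_on D uyx" "continuous_on D uyy"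
    "\<And>z. z \<in> D \<Longrightarrow> uxx z + uyy z = 0"
    using harm unfolding harmonic_on_def by blast
  obtain R where R: "0 < R" "\<And>z. z \<in> D \<Longrightarrow> cmod z \<le> R"
    using \<open>bounded D\<close> unfolding bounded_pos by blast
  \<comment> \<open>Chosen so that subtracting \<open>\<delta> * R^2\<close>, which makes \<open>w \<le> v\<close>, still leaves \<open>w z0\<close> positive.\<close>
  define \<delta> where "\<delta> = v z0 / (2 * R\<^sup>2)"
  have \<delta>: "0 < \<delta>" "\<delta> * R\<^sup>2 = v z0 / 2" using pos R(1) by (auto simp: \<delta>_def)
  define w where "w = (\<lambda>z. v z + \<delta> * ((Re z)\<^sup>2 + (Im z)\<^sup>2) - \<delta> * R\<^sup>2)"
  have w_le: "w z \<le> v z" if "z \<in> D" for z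
  proof -
    have "(Re z)\<^sup>2 + (Im z)\<^sup>2 = (cmod z)\<^sup>2" by (simp add: cmod_power2)
    also have "\<dots> \<le> R\<^sup>2" using R(2)[OF that] by (intro power_mono) auto
    finally show ?thesis using \<delta>(1) by (auto simp: w_def)
  qed
  define m where "m = w z0"
  have "0 \<le> \<delta> * ((Re z0)\<^sup>2 + (Im z0)\<^sup>2)" using \<delta>(1) by auto
  then have m: "0 < m" using pos \<delta>(2) by (auto simp: m_def w_def)
  \<comment> \<open>The boundary behaviour keeps \<open>K\<close> away from the frontier, so \<open>K\<close> is compact although \<open>D\<close> is not.\<close>
  define K where "K = {z \<in> D. m \<le> w z}"
  have cont_w: "isCont w z" if "z \<in> D" for z
    using has_derivative_continuous[OF u(2)[OF that]] by (auto simp: w_def intro!: continuous_intros)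
  have "closed K"
  proof (rule closed_limpt[THEN iffD2], intro allI impI)
    fix \<zeta> assume lim: "\<zeta> islimpt K"
    have limD: "\<zeta> islimpt D" using lim by (rule islimpt_subset) (auto simp: K_def)
    have "\<zeta> \<in> D"
    proof (rule ccontr)
      assume "\<zeta> \<notin> D"
      then have "\<zeta> \<in> frontier D"
        using limD \<open>open D\<close> by (auto simp: frontier_def closure_def interior_open)
      then have "\<forall>\<^sub>F z in at \<zeta> within D. v z < m" using bdry m by auto
      then obtain e where e: "0 < e" "\<And>z. z \<in> D \<Longrightarrow> 0 < dist z \<zeta> \<Longrightarrow> dist z \<zeta> < e \<Longrightarrow> v z < m"
        unfolding eventually_at by (metis zero_less_dist_iff)
      obtain z where "z \<in> K" "z \<noteq> \<zeta>" "dist z \<zeta> < e"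
        using lim e(1) unfolding islimpt_approachable by blast
      then show False using e(2)[of z] w_le[of z] by (auto simp: K_def)
    qed
    moreover have "m \<le> w \<zeta>"
    proof (rule tendsto_lowerbound)
      show "(w \<longlongrightarrow> w \<zeta>) (at \<zeta> within K)"
        using cont_w[OF \<open>\<zeta> \<in> D\<close>] by (simp add: continuous_at_imp_continuous_at_within continuous_within[symmetric])
      show "\<forall>\<^sub>F z in at \<zeta> within K. m \<le> w z" by (auto simp: eventually_at_filter K_def)
      show "at \<zeta> within K \<noteq> bot" using lim trivial_limit_within by blast
    qed
    ultimately show "\<zeta> \<in> K" by (simp add: K_def)
  qed
  moreover have "bounded K" using \<open>bounded D\<close> by (rule bounded_subset) (auto simp: K_def)
  ultimately have "compact K" by (simp add: compact_eq_bounded_closed)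
  moreover have "K \<noteq> {}" using \<open>z0 \<in> D\<close> by (auto simp: K_def m_def)
  moreover have "continuous_on K w"
    by (rule continuous_at_imp_continuous_on) (auto simp: K_def cont_w)
  ultimately obtain p where p: "p \<in> K" "\<And>z. z \<in> K \<Longrightarrow> w z \<le> w p"
    using continuous_attains_sup by metis
  have pD: "p \<in> D" and pmax: "\<And>z. z \<in> D \<Longrightarrow> w z \<le> w p"
    using p by (force simp: K_def)+
  obtain d where d: "0 < d" "ball p d \<subseteq> D" using pD \<open>open D\<close> openE by blast
  \<comment> \<open>The factor \<open>1\<close> is the direction of the line in \<open>has_real_derivative_along_line\<close>.\<close>
  have inD: "p + 1 * of_real s \<in> D" "p + \<i> * of_real s \<in> D" if "\<bar>s\<bar> < d" for s :: real
    using d(2) that by (auto simp: subset_iff dist_norm norm_mult)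
  have "uxx p + 2 * \<delta> \<le> 0"
  proof (rule local_max_second_derivative_nonpos[OF \<open>0 < d\<close>])
    fix s :: real assume s: "\<bar>s\<bar> < d"
    have "((\<lambda>s. v (p + 1 * of_real s)) has_real_derivative ux (p + 1 * of_real s)) (at s)"
      using has_real_derivative_along_line[OF u(2)[OF inD(1)[OF s]]] by simp
    then show "((\<lambda>s. w (p + 1 * of_real s)) has_real_derivative
        ux (p + 1 * of_real s) + 2 * \<delta> * (Re p + s)) (at s)"
      unfolding w_def by (auto intro!: derivative_eq_intros simp: algebra_simps)
    show "w (p + 1 * of_real s) \<le> w (p + 1 * of_real 0)" using pmax inD(1)[OF s] by simp
  next
    have "((\<lambda>s. ux (p + 1 * of_real s)) has_real_derivative uxx p) (at 0)"
      using has_real_derivative_along_line[of ux _ _ p 1 0] u(3)[OF pD] by fastforce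
    then show "((\<lambda>s. ux (p + 1 * of_real s) + 2 * \<delta> * (Re p + s)) has_real_derivative
        uxx p + 2 * \<delta>) (at 0)"
      by (auto intro!: derivative_eq_intros)
  qed
  moreover have "uyy p + 2 * \<delta> \<le> 0"
  proof (rule local_max_second_derivative_nonpos[OF \<open>0 < d\<close>])
    fix s :: real assume s: "\<bar>s\<bar> < d"
    have "((\<lambda>s. v (p + \<i> * of_real s)) has_real_derivative uy (p + \<i> * of_real s)) (at s)"
      using has_real_derivative_along_line[OF u(2)[OF inD(2)[OF s]]] by simp
    then show "((\<lambda>s. w (p + \<i> * of_real s)) has_real_derivative
        uy (p + \<i> * of_real s) + 2 * \<delta> * (Im p + s)) (at s)"
      unfolding w_def by (auto intro!: derivative_eq_intros simp: algebra_simps)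
    show "w (p + \<i> * of_real s) \<le> w (p + \<i> * of_real 0)" using pmax inD(2)[OF s] by simp
  next
    have "((\<lambda>s. uy (p + \<i> * of_real s)) has_real_derivative uyy p) (at 0)"
      using has_real_derivative_along_line[of uy _ _ p \<i> 0] u(4)[OF pD] by fastforce
    then show "((\<lambda>s. uy (p + \<i> * of_real s) + 2 * \<delta> * (Im p + s)) has_real_derivative
        uyy p + 2 * \<delta>) (at 0)"
      by (auto intro!: derivative_eq_intros)
  qed
  ultimately show False using u(9)[OF pD] \<delta>(1) by linarith
qed

section \<open>Green functions of bounded domains\<close>

text \<open>The difference \<open>G - H\<close> is bounded near the pole, but its values there are not controlled.  In
  \<open>G - (1 - e) * H\<close> the logarithms leave \<open>e * ln \<bar>z - q\<bar>\<close>, which forces it to \<open>-\<infinity>\<close> at \<open>q\<close>; the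
  maximum principle then gives \<open>G \<le> (1 - e) * H\<close>, and \<open>e\<close> tends to \<open>0\<close>.\<close>

lemma green_function_le:
  assumes "bounded D" "open D"
    and G: "is_green_function D q G" and H: "is_green_function D q H"
    and z: "z \<in> D - {q}"
  shows "real_of_ereal (G z) \<le> real_of_ereal (H z)"
proof -
  define g where "g = (\<lambda>z. real_of_ereal (G z))"
  define h where "h = (\<lambda>z. real_of_ereal (H z))"
  have harm: "harmonic_on g (D - {q})" "harmonic_on h (D - {q})"
    using G H by (auto simp: is_green_function_def g_def h_def)
  have to0: "((\<lambda>z. real_of_ereal (F z)) \<longlongrightarrow> 0) (at \<zeta> within D)"
    if "is_green_function D q F" "\<zeta> \<in> frontier D" for F \<zeta>
  proof -
    have "(F \<longlongrightarrow> ereal 0) (at \<zeta> within D)"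
      using that by (simp add: is_green_function_def zero_ereal_def)
    then show ?thesis by (rule lim_real_of_ereal)
  qed
  have ev_le: "g z \<le> (1 - e) * h z" if e: "0 < e" "e < 1" for e
  proof -
    have "1 * g z + (- (1 - e)) * h z \<le> 0"
    proof (rule harmonic_maximum_principle[OF _ harmonic_on_lincomb[OF harm]])
      show "bounded (D - {q})" using \<open>bounded D\<close> by (rule bounded_subset) auto
      show "z \<in> D - {q}" by (rule z)
      fix \<zeta> :: complex and \<eta> :: real
      assume "\<zeta> \<in> frontier (D - {q})" "0 < \<eta>"
      have "\<zeta> \<in> closure D" "\<zeta> \<notin> D - {q}"
        using \<open>\<zeta> \<in> frontier (D - {q})\<close> closure_mono[of "D - {q}" D] \<open>open D\<close>
        by (auto simp: frontier_def interior_open open_delete)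
      then consider "\<zeta> = q" | "\<zeta> \<in> frontier D"
        using \<open>open D\<close> by (auto simp: frontier_def interior_open)
      then show "\<forall>\<^sub>F z in at \<zeta> within D - {q}. 1 * g z + (- (1 - e)) * h z < \<eta>"
      proof cases
        case 1
        obtain a where a: "\<forall>\<^sub>F z in at q. \<bar>g z - ln (cmod (z - q))\<bar> \<le> a"
          using G by (auto simp: is_green_function_def g_def elim!: landau_o.bigE)
        obtain b where b: "\<forall>\<^sub>F z in at q. \<bar>h z - ln (cmod (z - q))\<bar> \<le> b"
          using H by (auto simp: is_green_function_def h_def elim!: landau_o.bigE)
        have "filterlim (\<lambda>z. cmod (z - q)) (at_right 0) (at q)"
          unfolding filterlim_at
          by (auto simp: eventually_at_filter intro!: tendsto_eq_intros)
        then have "filterlim (\<lambda>z. ln (cmod (z - q))) at_bot (at q)"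
          by (rule filterlim_compose[OF ln_at_0])
        then have "\<forall>\<^sub>F z in at q. ln (cmod (z - q)) \<le> - (\<bar>a\<bar> + \<bar>b\<bar>) / e"
          by (simp add: filterlim_at_bot)
        with a b have "\<forall>\<^sub>F z in at q. 1 * g z + (- (1 - e)) * h z < \<eta>"
        proof eventually_elim
          case (elim z)
          define l where "l = ln (cmod (z - q))"
          have "1 * g z + (- (1 - e)) * h z = (g z - l) - (1 - e) * (h z - l) + e * l"
            by (simp add: algebra_simps)
          also have "e * l \<le> - (\<bar>a\<bar> + \<bar>b\<bar>)"
            using elim(3) e by (simp add: l_def field_simps)
          also have "\<bar>(1 - e) * (h z - l)\<bar> \<le> 1 * b"
            unfolding abs_mult using elim(2) e by (intro mult_mono) (auto simp: l_def)
          then have "- ((1 - e) * (h z - l)) \<le> b" by linarith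
          then have "(g z - l) - (1 - e) * (h z - l) + - (\<bar>a\<bar> + \<bar>b\<bar>) \<le> 0"
            using elim(1) by (simp add: l_def)
          finally show ?case using \<open>0 < \<eta>\<close> by simp
        qed
        then show ?thesis using 1 filter_leD[OF at_le[OF subset_UNIV]] by blast
      next
        case 2
        have "((\<lambda>z. 1 * g z + (- (1 - e)) * h z) \<longlongrightarrow> 1 * 0 + (- (1 - e)) * 0) (at \<zeta> within D)"
          unfolding g_def h_def by (intro tendsto_intros to0[OF G 2] to0[OF H 2])
        then have "((\<lambda>z. 1 * g z + (- (1 - e)) * h z) \<longlongrightarrow> 0) (at \<zeta> within D)"
          by simp
        then have "\<forall>\<^sub>F z in at \<zeta> within D. 1 * g z + (- (1 - e)) * h z < \<eta>"
          by (rule order_tendstoD(2)) (rule \<open>0 < \<eta>\<close>)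
        then show ?thesis using filter_leD[OF at_le[OF Diff_subset]] by blast
      qed
    qed
    then show ?thesis by (simp add: algebra_simps)
  qed
  have "g z \<le> h z"
  proof (rule tendsto_le[of "at_right (0::real)"])
    have "((\<lambda>e. (1 - e) * h z) \<longlongrightarrow> (1 - 0) * h z) (at_right 0)"
      by (intro tendsto_intros)
    then show "((\<lambda>e. (1 - e) * h z) \<longlongrightarrow> h z) (at_right 0)" by simp
    show "\<forall>\<^sub>F e in at_right (0::real). g z \<le> (1 - e) * h z"
      by (rule eventually_mono[OF eventually_at_right_real[of 0 1]]) (auto intro: ev_le)
  qed (auto intro: tendsto_const)
  then show ?thesis by (simp add: g_def h_def)
qed

lemma green_function_unique:
  assumes "bounded D" "open D" "is_green_function D q G" "is_green_function D q H" "z \<in> D"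
  shows "G z = H z"
proof (cases "z = q")
  case True
  then show ?thesis using assms by (simp add: is_green_function_def)
next
  case False
  then have z: "z \<in> D - {q}" using assms by simp
  have "real_of_ereal (G z) = real_of_ereal (H z)"
    using green_function_le[OF assms(1,2) _ _ z] assms(3,4) by (meson order_antisym)
  moreover have "\<bar>G z\<bar> \<noteq> \<infinity>" "\<bar>H z\<bar> \<noteq> \<infinity>" using assms(3,4) z by (auto simp: is_green_function_def)
  ultimately show ?thesis by (metis ereal_real)
qed

text \<open>Needed because \<open>is_green_function\<close> mentions \<open>G\<close> as a function on the whole plane; its derivatives,
  its behaviour at the pole and its boundary limits see only the values inside \<open>D\<close>.\<close>

lemma green_function_cong:
  assumes G: "is_green_function D q G" and "open D" and eq: "\<And>z. z \<in> D \<Longrightarrow> H z = G z"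
  shows "is_green_function D q H"
proof -
  have q: "q \<in> D" using G by (simp add: is_green_function_def)
  have harm: "harmonic_on (\<lambda>z. real_of_ereal (H z)) (D - {q})"
    by (rule harmonic_on_cong[where u="\<lambda>z. real_of_ereal (G z)"])
      (use G eq in \<open>auto simp: is_green_function_def\<close>)
  have near: "\<forall>\<^sub>F z in at q. z \<in> D"
    using q \<open>open D\<close> by (rule eventually_at_in_open'[rotated])
  have "(\<lambda>z. real_of_ereal (G z) - ln (cmod (z - q))) \<in> O[at q](\<lambda>_. 1)"
    using G by (simp add: is_green_function_def)
  moreover have "\<forall>\<^sub>F z in at q. real_of_ereal (G z) - ln (cmod (z - q)) = real_of_ereal (H z) - ln (cmod (z - q))"
    using near by eventually_elim (simp add: eq)
  ultimately have pole: "(\<lambda>z. real_of_ereal (H z) - ln (cmod (z - q))) \<in> O[at q](\<lambda>_. 1)"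
    by (simp only: landau_o.big.in_cong)
  have "(H \<longlongrightarrow> 0) (at \<zeta> within D)" if "\<zeta> \<in> frontier D" for \<zeta>
  proof (rule Lim_transform_eventually)
    show "(G \<longlongrightarrow> 0) (at \<zeta> within D)" using G that by (simp add: is_green_function_def)
    show "\<forall>\<^sub>F z in at \<zeta> within D. G z = H z" by (simp add: eventually_at_filter eq)
  qed
  moreover have "\<forall>z\<in>D - {q}. \<bar>H z\<bar> \<noteq> \<infinity>"
    using G eq unfolding is_green_function_def by auto
  ultimately show ?thesis using harm pole G eq by (simp add: is_green_function_def)
qed

text \<open>On a component without the pole, \<open>- G\<close> would be harmonic with boundary limits zero (the frontier of
  a component lies in the frontier of \<open>D\<close>), hence nonpositive, whereas \<open>G < 0\<close>.\<close>

lemma green_function_domain_connected: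
  assumes "bounded D" "open D" and G: "is_green_function D q G"
  shows "connected D"
proof -
  define g where "g = (\<lambda>z. real_of_ereal (G z))"
  have harm: "harmonic_on g (D - {q})"
    using G by (simp add: is_green_function_def g_def)
  have "connected_component D w q" if w: "w \<in> D" for w
  proof (rule ccontr)
    assume notin: "\<not> connected_component D w q"
    define C where "C = connected_component_set D w"
    have C: "C \<subseteq> D - {q}" "open C" "w \<in> C" "bounded C"
      using notin connected_component_subset[of D w] \<open>open D\<close> w bounded_subset[OF \<open>bounded D\<close>]
      by (auto simp: C_def open_connected_component connected_component_refl)
    \<comment> \<open>The shape of \<open>- g\<close> matches the linear combinations of \<open>harmonic_on_lincomb\<close>.\<close>
    have le: "0 * g w + (-1) * g w \<le> 0"
    proof (rule harmonic_maximum_principle[where D = C])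
      show "harmonic_on (\<lambda>z. 0 * g z + (-1) * g z) C"
        using C by (intro harmonic_on_lincomb harmonic_on_subset[OF harm])
      fix \<zeta> :: complex and e :: real
      assume "\<zeta> \<in> frontier C" "0 < e"
      then have "\<zeta> \<in> frontier D"
        using frontier_of_connected_component_subset by (auto simp: C_def)
      then have "(G \<longlongrightarrow> ereal 0) (at \<zeta> within D)"
        using G by (simp add: is_green_function_def zero_ereal_def)
      then have "(g \<longlongrightarrow> 0) (at \<zeta> within D)"
        unfolding g_def by (rule lim_real_of_ereal)
      then have "(g \<longlongrightarrow> 0) (at \<zeta> within C)"
        by (rule tendsto_within_subset) (use C in auto)
      then have "\<forall>\<^sub>F z in at \<zeta> within C. - e < g z"
        by (rule order_tendstoD(1)) (use \<open>0 < e\<close> in simp)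
      then show "\<forall>\<^sub>F z in at \<zeta> within C. 0 * g z + (-1) * g z < e"
        by (rule eventually_mono) simp
    qed (use C in auto)
    have "w \<in> D - {q}" using C by blast
    have "\<forall>z\<in>D. G z < 0"
      using G unfolding is_green_function_def by (elim conjE)
    then have "G w < 0" using w by (rule bspec)
    moreover have "\<forall>z\<in>D - {q}. \<bar>G z\<bar> \<noteq> \<infinity>"
      using G unfolding is_green_function_def by (elim conjE)
    then have "\<bar>G w\<bar> \<noteq> \<infinity>" using \<open>w \<in> D - {q}\<close> by (rule bspec)
    ultimately have "g w < 0" by (cases "G w") (auto simp: g_def)
    with le show False by simp
  qed
  then have "connected_component_set D q = D"
    using connected_component_subset[of D q] by (auto simp: connected_component_sym)
  then show ?thesis by (metis connected_connected_component)
qed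

section \<open>Sublevel sets of the rational function\<close>

definition pole_factor :: "complex \<Rightarrow> complex" where
  "pole_factor w = 1 - 3 * w + 3 * w ^ 2"

text \<open>Where \<open>\<bar>w^3 / pole_factor w\<bar> < c\<close>, in a form without division, so that zeros of the
  denominator are excluded and the set is visibly open.\<close>

definition sublevel :: "real \<Rightarrow> complex set" where
  "sublevel c = {w. cmod w ^ 3 < c * cmod (pole_factor w)}"

text \<open>This identity makes \<open>1\<close> a critical point: \<open>pole_factor w / w^3\<close> differs from \<open>1\<close> by the cube of
  \<open>(w - 1) / w\<close>.\<close>

lemma pole_factor_eq_diff_cubes: "pole_factor w = w ^ 3 - (w - 1) ^ 3"
  by (simp add: pole_factor_def power2_eq_square power3_eq_cube algebra_simps)

lemma isCont_pole_factor [continuous_intros]: "isCont pole_factor w"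
  unfolding pole_factor_def[abs_def] by (intro continuous_intros)

lemma csphere_value_Fin:
  assumes "w \<noteq> 0"
  shows "csphere_abs (csphere_cubic (csphere_recip (Fin w))) = ereal (cmod (pole_factor w) / cmod w ^ 3)"
proof -
  have "(1 / w - 1) ^ 3 + 1 = pole_factor w / w ^ 3"
    using assms by (simp add: pole_factor_eq_diff_cubes field_simps power3_eq_cube)
  then show ?thesis using assms by (simp add: norm_divide norm_power)
qed

lemma Omega_eq_sublevel: "Omega = sublevel (exp (1 / 3))"
proof (rule set_eqI)
  fix w
  show "w \<in> Omega \<longleftrightarrow> w \<in> sublevel (exp (1 / 3))"
  proof (cases "w = 0")
    case True
    then show ?thesis by (simp add: Omega_def Omega_sphere_def sublevel_def pole_factor_def)
  next
    case False
    have "w \<in> Omega \<longleftrightarrow> exp (- 1 / 3) < cmod (pole_factor w) / cmod w ^ 3"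
      unfolding Omega_def Omega_sphere_def mem_Collect_eq csphere_value_Fin[OF False] by simp
    also have "\<dots> \<longleftrightarrow> w \<in> sublevel (exp (1 / 3))"
      using False by (simp add: sublevel_def exp_minus field_simps)
    finally show ?thesis .
  qed
qed

lemma Omega_sphere_eq: "Omega_sphere = Fin ` Omega"
proof -
  have "Infty \<notin> Omega_sphere" by (simp add: Omega_sphere_def)
  then have "w \<in> Omega_sphere \<longleftrightarrow> w \<in> Fin ` Omega" for w
    by (cases w) (auto simp: Omega_def)
  then show ?thesis by blast
qed

lemma open_sublevel: "open (sublevel c)"
  unfolding sublevel_def pole_factor_def by (intro open_Collect_less continuous_intros)

lemma bounded_sublevel: "bounded (sublevel c)"
proof (rule boundedI)
  fix w assume w: "w \<in> sublevel c"
  show "cmod w \<le> max 1 (7 * \<bar>c\<bar>)"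
  proof (rule ccontr)
    assume "\<not> ?thesis"
    then have *: "1 < cmod w" "7 * \<bar>c\<bar> < cmod w" by auto
    have "cmod (pole_factor w) \<le> cmod 1 + cmod (3 * w) + cmod (3 * w ^ 2)"
      unfolding pole_factor_def by (rule order_trans[OF norm_triangle_ineq])
        (rule add_right_mono, rule norm_triangle_ineq4)
    also have "\<dots> = 1 + 3 * cmod w + 3 * cmod w ^ 2" by (simp add: norm_mult norm_power)
    also have "\<dots> \<le> 7 * cmod w ^ 2"
      using * self_le_power[of "cmod w" 2] by simp
    finally have "\<bar>c\<bar> * cmod (pole_factor w) \<le> \<bar>c\<bar> * (7 * cmod w ^ 2)"
      by (intro mult_left_mono) auto
    also have "\<dots> = (7 * \<bar>c\<bar>) * cmod w ^ 2" by simp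
    also have "\<dots> \<le> cmod w * cmod w ^ 2" using * by (intro mult_right_mono) auto
    also have "\<dots> = cmod w ^ 3" by (simp add: power2_eq_square power3_eq_cube)
    finally have "\<bar>c\<bar> * cmod (pole_factor w) \<le> cmod w ^ 3" .
    moreover have "c * cmod (pole_factor w) \<le> \<bar>c\<bar> * cmod (pole_factor w)"
      by (intro mult_right_mono) auto
    ultimately show False using w by (auto simp: sublevel_def)
  qed
qed

lemma sublevel_mono: "c \<le> d \<Longrightarrow> sublevel c \<subseteq> sublevel d"
  unfolding sublevel_def by (force intro: less_le_trans mult_right_mono)

lemma zero_in_sublevel: "0 < c \<Longrightarrow> 0 \<in> sublevel c"
  by (simp add: sublevel_def pole_factor_def)

lemma pole_factor_nonzero_on_sublevel: "w \<in> sublevel c \<Longrightarrow> pole_factor w \<noteq> 0"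
  using zero_le_power[OF norm_ge_zero, of w 3] by (auto simp: sublevel_def)

section \<open>The explicit Green function\<close>

lemma G_Omega_eq:
  assumes "w \<noteq> 0" "pole_factor w \<noteq> 0"
  shows "G_Omega w = ereal (ln (cmod w) - ln (cmod (pole_factor w)) / 3 - 1 / 9)"
  using assms unfolding G_Omega_def pole_factor_def[symmetric]
  by (simp add: norm_divide norm_power ln_div ln_realpow algebra_simps)

lemma G_Omega_less_iff:
  assumes "pole_factor w \<noteq> 0"
  shows "G_Omega w < ereal t \<longleftrightarrow> w \<in> sublevel (exp (3 * t + 1 / 3))"
proof (cases "w = 0")
  case True
  then show ?thesis by (simp add: G_Omega_def zero_in_sublevel)
next
  case False
  have "w \<in> sublevel (exp (3 * t + 1 / 3)) \<longleftrightarrow>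
      ln (cmod w ^ 3) < ln (exp (3 * t + 1 / 3) * cmod (pole_factor w))"
    using assms False by (subst ln_less_cancel_iff) (auto simp: sublevel_def)
  also have "\<dots> \<longleftrightarrow> 3 * ln (cmod w) < 3 * t + 1 / 3 + ln (cmod (pole_factor w))"
    using assms False by (simp add: ln_realpow ln_mult)
  finally show ?thesis using assms False by (simp add: G_Omega_eq) argo
qed

lemma sublevel_of_G_Omega:
  assumes "t \<le> 0"
  shows "{w \<in> Omega. G_Omega w < ereal t} = sublevel (exp (3 * t + 1 / 3))"
  using sublevel_mono[of "exp (3 * t + 1 / 3)" "exp (1 / 3)"] assms
  by (auto simp: Omega_eq_sublevel G_Omega_less_iff[OF pole_factor_nonzero_on_sublevel])

text \<open>Up to a constant, the function is one third of \<open>ln \<bar>w^3 / pole_factor w\<bar>\<close>; the function \<open>h\<close> of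
  \<open>harmonic_on_Re_antiderivative\<close> is one third of the logarithmic derivative of that quotient.\<close>

lemma harmonic_on_G_Omega:
  "harmonic_on (\<lambda>w. real_of_ereal (G_Omega w)) {w. w \<noteq> 0 \<and> pole_factor w \<noteq> 0}"
    (is "harmonic_on _ ?S")
proof -
  have "open ?S"
    unfolding pole_factor_def by (intro open_Collect_conj open_Collect_neq continuous_intros)
  have log: "((\<lambda>w. ln (cmod w) - ln (cmod (pole_factor w)) / 3 - 1 / 9) has_derivative
      (\<lambda>k. Re ((1 / w - (2 * w - 1) / pole_factor w) * k))) (at w)" if "w \<in> ?S" for w
  proof -
    have "(pole_factor has_field_derivative (6 * w - 3)) (at w)"
      unfolding pole_factor_def[abs_def] by (auto intro!: derivative_eq_intros)
    from has_derivative_ln_cmod[OF this]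
    have "((\<lambda>w. ln (cmod (pole_factor w)) * (1 / 3)) has_derivative
        (\<lambda>k. Re ((6 * w - 3) / pole_factor w * k) * (1 / 3))) (at w)"
      using that by (intro has_derivative_mult_left) auto
    then have "((\<lambda>w. ln (cmod (pole_factor w)) / 3) has_derivative
        (\<lambda>k. Re ((6 * w - 3) / pole_factor w * k) / 3)) (at w)"
      by simp
    moreover have "Re ((6 * w - 3) / pole_factor w * k) / 3 = Re ((2 * w - 1) / pole_factor w * k)" for k
    proof -
      have "(6 * w - 3) / pole_factor w * k = 3 * ((2 * w - 1) / pole_factor w * k)"
        using that by (simp add: field_simps)
      moreover have "Re (3 * x) = 3 * Re x" for x :: complex by simp
      ultimately have "Re ((6 * w - 3) / pole_factor w * k) = 3 * Re ((2 * w - 1) / pole_factor w * k)"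
        by (simp only:)
      then show ?thesis by simp
    qed
    ultimately have Q: "((\<lambda>w. ln (cmod (pole_factor w)) / 3) has_derivative
        (\<lambda>k. Re ((2 * w - 1) / pole_factor w * k))) (at w)"
      by simp
    have "((\<lambda>w. ln (cmod w)) has_derivative (\<lambda>k. Re (1 / w * k))) (at w)"
      using that by (intro has_derivative_ln_cmod) (auto intro!: derivative_eq_intros)
    from has_derivative_diff[OF has_derivative_diff[OF this Q] has_derivative_const[of "1/9"]]
    show ?thesis by (simp only: left_diff_distrib minus_complex.sel diff_0_right)
  qed
  have "harmonic_on (\<lambda>w. ln (cmod w) - ln (cmod (pole_factor w)) / 3 - 1 / 9) ?S"
  proof (rule harmonic_on_Re_antiderivative[OF \<open>open ?S\<close> log])
    show "((\<lambda>w. 1 / w - (2 * w - 1) / pole_factor w) has_field_derivative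
        - 1 / w ^ 2 - (2 * pole_factor w - (2 * w - 1) * (6 * w - 3)) / pole_factor w ^ 2) (at w)"
      if "w \<in> ?S" for w
      using that unfolding pole_factor_def[abs_def]
      by (auto intro!: derivative_eq_intros simp: power2_eq_square)
    show "continuous_on ?S (\<lambda>w. - 1 / w ^ 2 -
        (2 * pole_factor w - (2 * w - 1) * (6 * w - 3)) / pole_factor w ^ 2)"
      unfolding pole_factor_def by (intro continuous_intros) auto
  qed
  then show ?thesis
    by (rule harmonic_on_cong) (simp add: G_Omega_eq)
qed

lemma green_function_G_Omega: "is_green_function Omega 0 G_Omega"
  unfolding is_green_function_def
proof (intro conjI ballI)
  show "0 \<in> Omega" by (simp add: Omega_eq_sublevel zero_in_sublevel)
  show "G_Omega 0 = - \<infinity>" by (simp add: G_Omega_def)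
  show "G_Omega w < 0" if "w \<in> Omega" for w
    using sublevel_of_G_Omega[of 0] that by (auto simp: Omega_eq_sublevel zero_ereal_def)
  show "\<bar>G_Omega w\<bar> \<noteq> \<infinity>" if "w \<in> Omega - {0}" for w
    using that by (simp add: G_Omega_def)
  show "harmonic_on (\<lambda>w. real_of_ereal (G_Omega w)) (Omega - {0})"
    using harmonic_on_G_Omega
  proof (rule harmonic_on_subset)
    show "open (Omega - {0})" unfolding Omega_eq_sublevel by (intro open_delete open_sublevel)
  qed (auto simp: Omega_eq_sublevel pole_factor_nonzero_on_sublevel)
  show "(\<lambda>w. real_of_ereal (G_Omega w) - ln (cmod (w - 0))) \<in> O[at 0](\<lambda>_. 1)"
  proof (rule bigoI_tendsto)
    have Q0: "pole_factor 0 = 1" by (simp add: pole_factor_def)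
    have lim: "(pole_factor \<longlongrightarrow> 1) (at 0)"
      using isCont_pole_factor[of 0] by (simp add: isCont_def Q0)
    have "((\<lambda>w. - ln (cmod (pole_factor w)) / 3 - 1 / 9) \<longlongrightarrow> - ln (cmod 1) / 3 - 1 / 9) (at 0)"
      by (intro tendsto_intros lim) auto
    then show "((\<lambda>w. (real_of_ereal (G_Omega w) - ln (cmod (w - 0))) / 1) \<longlongrightarrow> - ln (cmod 1) / 3 - 1 / 9) (at 0)"
    proof (rule Lim_transform_eventually)
      have "\<forall>\<^sub>F w in at 0. pole_factor w \<noteq> 0"
        by (rule tendsto_imp_eventually_ne[OF lim]) simp
      moreover have "\<forall>\<^sub>F w in at (0::complex). w \<noteq> 0" by (simp add: eventually_at_filter)
      ultimately show "\<forall>\<^sub>F w in at 0. - ln (cmod (pole_factor w)) / 3 - 1 / 9 =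
          (real_of_ereal (G_Omega w) - ln (cmod (w - 0))) / 1"
        by eventually_elim (simp add: G_Omega_eq)
    qed
  qed simp
  fix \<zeta> assume \<zeta>: "\<zeta> \<in> frontier Omega"
  have "frontier Omega \<subseteq> {w. cmod w ^ 3 = exp (1 / 3) * cmod (pole_factor w)}"
  proof -
    have "closure Omega \<subseteq> {w. cmod w ^ 3 \<le> exp (1 / 3) * cmod (pole_factor w)}"
      unfolding pole_factor_def Omega_eq_sublevel sublevel_def
      by (intro closure_minimal closed_Collect_le continuous_intros) auto
    then show ?thesis
      by (auto simp: frontier_def Omega_eq_sublevel interior_open[OF open_sublevel])
        (auto simp: sublevel_def)
  qed
  with \<zeta> have eq: "cmod \<zeta> ^ 3 = exp (1 / 3) * cmod (pole_factor \<zeta>)" by blast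
  have nz: "\<zeta> \<noteq> 0" "pole_factor \<zeta> \<noteq> 0"
    using eq by (auto simp: pole_factor_def)
  have "3 * ln (cmod \<zeta>) = 1 / 3 + ln (cmod (pole_factor \<zeta>))"
    using arg_cong[OF eq, of ln] nz by (simp add: ln_realpow ln_mult)
  then have zero: "ln (cmod \<zeta>) - ln (cmod (pole_factor \<zeta>)) / 3 - 1 / 9 = 0" by simp
  have limQ: "(pole_factor \<longlongrightarrow> pole_factor \<zeta>) (at \<zeta> within Omega)"
    using isCont_pole_factor[of \<zeta>] by (simp add: continuous_at_imp_continuous_at_within flip: continuous_within)
  have "((\<lambda>w. ln (cmod w) - ln (cmod (pole_factor w)) / 3 - 1 / 9) \<longlongrightarrow>
      ln (cmod \<zeta>) - ln (cmod (pole_factor \<zeta>)) / 3 - 1 / 9) (at \<zeta> within Omega)"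
    by (intro tendsto_intros limQ) (use nz in auto)
  then have "((\<lambda>w. ereal (ln (cmod w) - ln (cmod (pole_factor w)) / 3 - 1 / 9)) \<longlongrightarrow> ereal 0) (at \<zeta> within Omega)"
    unfolding zero by (rule tendsto_ereal)
  then show "(G_Omega \<longlongrightarrow> 0) (at \<zeta> within Omega)"
    unfolding zero_ereal_def
  proof (rule Lim_transform_eventually)
    have "\<forall>\<^sub>F w in at \<zeta> within Omega. pole_factor w \<noteq> 0"
      by (rule tendsto_imp_eventually_ne[OF limQ nz(2)])
    moreover have "\<forall>\<^sub>F w in at \<zeta> within Omega. w \<noteq> 0"
      by (rule tendsto_imp_eventually_ne[OF tendsto_ident_at nz(1)])
    ultimately show "\<forall>\<^sub>F w in at \<zeta> within Omega.
        ereal (ln (cmod w) - ln (cmod (pole_factor w)) / 3 - 1 / 9) = G_Omega w"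
      by eventually_elim (simp add: G_Omega_eq)
  qed
qed

section \<open>Area growth at the critical level\<close>

text \<open>With \<open>s = 8 * r^3\<close> and \<open>\<bar>w\<bar> > 1/2\<close> on the disc, \<open>\<bar>w - 1\<bar>^3 \<le> s * \<bar>w\<bar>^3\<close>, so that
  \<open>\<bar>pole_factor w\<bar> / \<bar>w\<bar>^3\<close> lies between \<open>1 - s\<close> and \<open>1 + s\<close>.  The exponent is \<open>2 * s\<close> because
  \<open>exp s * (1 - s) < 1\<close>, whereas \<open>exp (2 * s) * (1 - s) > 1\<close> for small \<open>s\<close>.\<close>

lemma ball_between_sublevels:
  assumes r: "0 < r" "r \<le> 1 / 4"
  shows "ball 1 r \<subseteq> sublevel (exp (16 * r ^ 3)) - sublevel (exp (- (16 * r ^ 3)))"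
proof
  fix w :: complex assume "w \<in> ball 1 r"
  then have v: "cmod (w - 1) < r" by (simp add: dist_norm norm_minus_commute)
  define s where "s = 8 * r ^ 3"
  have "r ^ 3 \<le> (1 / 4) ^ 3" using r by (intro power_mono) auto
  then have s: "0 < s" "s \<le> 1 / 8" using r by (auto simp: s_def power3_eq_cube)
  have "1 \<le> cmod w + cmod (w - 1)"
    using norm_triangle_ineq4[of w "w - 1"] by simp
  then have w: "1 / 2 < cmod w" using v r by linarith
  then have w3: "1 / 8 < cmod w ^ 3"
    using power_strict_mono[of "1 / 2" "cmod w" 3] by (simp add: power3_eq_cube)
  have "cmod (w - 1) ^ 3 < r ^ 3" using v by (intro power_strict_mono) auto
  also have "r ^ 3 = s / 8" by (simp add: s_def)
  also have "s / 8 < s * cmod w ^ 3" using w3 s by simp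
  finally have v3: "cmod ((w - 1) ^ 3) < s * cmod w ^ 3" by (simp add: norm_power)
  have up: "cmod (pole_factor w) \<le> (1 + s) * cmod w ^ 3"
    using norm_triangle_ineq4[of "w ^ 3" "(w - 1) ^ 3"] v3
    by (simp add: pole_factor_eq_diff_cubes norm_power algebra_simps)
  have low: "(1 - s) * cmod w ^ 3 \<le> cmod (pole_factor w)"
    using norm_triangle_ineq2[of "w ^ 3" "(w - 1) ^ 3"] v3
    by (simp add: pole_factor_eq_diff_cubes norm_power algebra_simps)
  have "exp (- (2 * s)) * cmod (pole_factor w) \<le> exp (- (2 * s)) * ((1 + s) * cmod w ^ 3)"
    using up by (intro mult_left_mono) auto
  also have "1 + s \<le> exp (2 * s)"
    using exp_ge_add_one_self[of "2 * s"] s by linarith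
  then have "exp (- (2 * s)) * ((1 + s) * cmod w ^ 3) \<le> exp (- (2 * s)) * (exp (2 * s) * cmod w ^ 3)"
    by (intro mult_left_mono mult_right_mono) auto
  also have "\<dots> = cmod w ^ 3" by (simp add: exp_minus)
  finally have "w \<notin> sublevel (exp (- (2 * s)))" by (simp add: sublevel_def)
  moreover have "w \<in> sublevel (exp (2 * s))"
  proof -
    have "2 * s * s < s" using s by simp
    then have "1 < (1 + 2 * s) * (1 - s)" by (simp add: algebra_simps)
    also have "\<dots> \<le> exp (2 * s) * (1 - s)"
      using exp_ge_add_one_self[of "2 * s"] s by (intro mult_right_mono) auto
    finally have "1 * cmod w ^ 3 < exp (2 * s) * (1 - s) * cmod w ^ 3"
      by (rule mult_strict_right_mono) (use w3 in linarith)
    also have "\<dots> \<le> exp (2 * s) * cmod (pole_factor w)"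
      using low by (simp add: mult.assoc)
    finally show ?thesis by (simp add: sublevel_def)
  qed
  ultimately show "w \<in> sublevel (exp (16 * r ^ 3)) - sublevel (exp (- (16 * r ^ 3)))"
    by (simp add: s_def)
qed

lemma lmeasurable_sublevel: "sublevel c \<in> lmeasurable"
  using bounded_sublevel open_sublevel by (rule lmeasurable_open)

lemma area_jump_at_critical_level:
  assumes r: "0 < r" "r \<le> 1 / 4"
  shows "measure lebesgue (sublevel (exp (- (16 * r ^ 3)))) + pi * r ^ 2
    \<le> measure lebesgue (sublevel (exp (16 * r ^ 3)))"
proof -
  let ?A = "sublevel (exp (- (16 * r ^ 3)))" and ?B = "sublevel (exp (16 * r ^ 3))"
  have sub: "ball 1 r \<subseteq> ?B - ?A" by (rule ball_between_sublevels[OF r])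
  have "?A \<subseteq> ?B" using r by (intro sublevel_mono) simp
  have "measure lebesgue (ball (1::complex) r) = pi * r ^ 2"
    using r by (simp add: content_ball unit_ball_vol_2)
  moreover have "?A \<inter> ball 1 r = {}" using sub by blast
  then have "measure lebesgue (?A \<union> ball 1 r) = measure lebesgue ?A + measure lebesgue (ball (1::complex) r)"
    by (simp add: measure_Un3 lmeasurable_sublevel)
  moreover have "measure lebesgue (?A \<union> ball 1 r) \<le> measure lebesgue ?B"
    using sub \<open>?A \<subseteq> ?B\<close>
    by (intro measure_mono_fmeasurable lmeasurable_sublevel fmeasurableD fmeasurable.Un) auto
  ultimately show ?thesis by simp
qed

lemma measure_sublevel_pos:
  assumes "0 < c"
  shows "0 < measure lebesgue (sublevel c)"
proof -
  obtain e where e: "0 < e" "ball 0 e \<subseteq> sublevel c"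
    using zero_in_sublevel[OF assms] open_sublevel openE by blast
  have "0 < measure lebesgue (ball (0::complex) e)"
    using content_ball_pos[OF e(1), of "0::complex"] by simp
  also have "\<dots> \<le> measure lebesgue (sublevel c)"
    using e(2) by (intro measure_mono_fmeasurable lmeasurable_sublevel) auto
  finally show ?thesis .
qed

text \<open>The slope of a convex function over \<open>{a..b}\<close>, a shrinking interval about \<open>- 1/9\<close>, is at most the
  slope over \<open>{a..c}\<close> for the fixed \<open>c = - 1/27\<close>, hence bounded.  Monotonicity bounds the value at
  \<open>a\<close> from below by the value at \<open>- 1\<close>.  The area increment of order \<open>r^2\<close> over a length of order
  \<open>r^3\<close> contradicts this as \<open>r\<close> tends to \<open>0\<close>.\<close>

lemma not_convex_log_area:
  assumes f: "\<And>t. t < 0 \<Longrightarrow> f t = ln (measure lebesgue (sublevel (exp (3 * t + 1 / 3))))"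
  shows "\<not> convex_on {..<0::real} f"
proof
  assume conv: "convex_on {..<0} f"
  define m where "m = (\<lambda>t::real. measure lebesgue (sublevel (exp (3 * t + 1 / 3))))"
  have f_eq: "f t = ln (m t)" if "t < 0" for t using f[OF that] by (simp add: m_def)
  have m_pos: "0 < m t" for t by (simp add: m_def measure_sublevel_pos)
  have m_mono: "m s \<le> m t" if "s \<le> t" for s t
    unfolding m_def using that
    by (intro measure_mono_fmeasurable sublevel_mono lmeasurable_sublevel fmeasurableD) auto
  have f_mono: "f s \<le> f t" if "s \<le> t" "t < 0" for s t
    using m_mono[OF that(1)] m_pos that by (simp add: f_eq)
  define c :: real where "c = - 1 / 27"
  define L where "L = f c - f (- 1)"
  have "0 \<le> L" using f_mono[of "- 1" c] by (simp add: L_def c_def)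
  have bound: "pi \<le> 144 * m c * L * r" if r: "0 < r" "r \<le> 1 / 6" for r
  proof -
    \<comment> \<open>The levels at which \<open>exp (3 * t + 1/3)\<close> is \<open>exp (- 16 * r^3)\<close> and \<open>exp (16 * r^3)\<close>.\<close>
    define a b where "a = - 1 / 9 - 16 * r ^ 3 / 3" and "b = - 1 / 9 + 16 * r ^ 3 / 3"
    have "r ^ 3 \<le> (1 / 6) ^ 3" using r by (intro power_mono) auto
    moreover have "0 < r ^ 3" using r by simp
    ultimately have r3: "0 < r ^ 3" "r ^ 3 \<le> 1 / 216" by (simp_all add: power3_eq_cube)
    have ord: "- 1 \<le> a" "a < b" "b \<le> c" "c < 0" "2 / 27 \<le> c - a"
      using r3 by (auto simp: a_def b_def c_def)
    have "m a + pi * r ^ 2 \<le> m b"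
      using area_jump_at_critical_level[of r] r by (simp add: m_def a_def b_def)
    then have "pi * r ^ 2 / m b \<le> (m b - m a) / m b"
      using m_pos[of b] by (intro divide_right_mono) auto
    also have "\<dots> \<le> f b - f a"
      using ln_diff_le[OF m_pos[of a] m_pos[of b]] ord by (simp add: f_eq diff_divide_distrib)
    also have "convex_on {a..c} f"
      using ord convex_on_subset[OF conv] by (simp add: subset_iff)
    then have "f b - f a \<le> (f c - f a) / (c - a) * (b - a)"
      using convex_onD_Icc'[of a c f b] ord by simp
    also have "\<dots> \<le> L / (2 / 27) * (b - a)"
    proof (intro mult_right_mono frac_le)
      show "f c - f a \<le> L" using f_mono[of "- 1" a] ord by (simp add: L_def)
    qed (use ord \<open>0 \<le> L\<close> in auto)
    also have "\<dots> = 144 * L * r ^ 3" by (simp add: a_def b_def)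
    finally have "pi * r ^ 2 \<le> 144 * L * r ^ 3 * m b"
      using m_pos[of b] by (simp add: pos_divide_le_eq)
    also have "\<dots> \<le> 144 * L * r ^ 3 * m c"
      using m_mono ord \<open>0 \<le> L\<close> r by (intro mult_left_mono) auto
    also have "\<dots> = (144 * m c * L * r) * r ^ 2"
      by (simp add: power2_eq_square power3_eq_cube)
    finally show ?thesis using r by (simp add: mult_le_cancel_right)
  qed
  define K where "K = 144 * m c * L"
  have K: "0 \<le> K" using m_pos[of c] \<open>0 \<le> L\<close> by (simp add: K_def)
  \<comment> \<open>Any \<open>r \<le> 1/6\<close> with \<open>K * r < pi\<close> refutes the bound.\<close>
  have "pi \<le> K * (1 / (6 + K))"
    unfolding K_def
  proof (rule bound)
    show "0 < 1 / (6 + 144 * m c * L)" "1 / (6 + 144 * m c * L) \<le> 1 / 6"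
      using K unfolding K_def[symmetric] by (simp_all add: field_simps)
  qed
  also have "\<dots> < 1" using K by simp
  finally show False using pi_gt3 by simp
qed

theorem corollary2p4:
  "Omega_sphere = Fin ` Omega \<and>
   open Omega \<and> connected Omega \<and> bounded Omega \<and> 0 \<in> Omega \<and>
   (\<forall>G. is_green_function Omega 0 G \<longleftrightarrow> (\<forall>w\<in>Omega. G w = G_Omega w)) \<and>
   (\<forall>G. is_green_function Omega 0 G \<longrightarrow>
      \<not> convex_on {..<0::real}
          (\<lambda>t. ln (measure lebesgue {w \<in> Omega. G w < ereal t})))"
proof (intro conjI allI impI)
  show op: "open Omega" and bd: "bounded Omega" and "0 \<in> Omega"
    by (simp_all add: Omega_eq_sublevel open_sublevel bounded_sublevel zero_in_sublevel)
  show "Omega_sphere = Fin ` Omega" by (rule Omega_sphere_eq)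
  show "connected Omega"
    by (rule green_function_domain_connected[OF bd op green_function_G_Omega])
  show iff: "is_green_function Omega 0 G \<longleftrightarrow> (\<forall>w\<in>Omega. G w = G_Omega w)" for G
    using green_function_unique[OF bd op _ green_function_G_Omega]
      green_function_cong[OF green_function_G_Omega op] by blast
  fix G assume "is_green_function Omega 0 G"
  then have eq: "\<forall>w\<in>Omega. G w = G_Omega w" using iff by blast
  have "{w \<in> Omega. G w < ereal t} = sublevel (exp (3 * t + 1 / 3))" if "t \<in> {..<0}" for t
  proof -
    have "{w \<in> Omega. G w < ereal t} = {w \<in> Omega. G_Omega w < ereal t}" using eq by auto
    then show ?thesis using sublevel_of_G_Omega[of t] that by simp
  qed
  then show "\<not> convex_on {..<0::real} (\<lambda>t. ln (measure lebesgue {w \<in> Omega. G w < ereal t}))"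
    by (intro not_convex_log_area) simp
qed

end
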